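(* Let $\varphi$ be any finite-time STL specification over discrete-time signals $x:\mathbb{Z}_+\to\mathbb{R}^n$, all of whose predicate functions $f:\mathbb{R}^n\to\mathbb{R}$ are $\mathcal{C}^1$-smooth, and let $k\in\mathbb{Z}_+$. Let the parameters of the D-GMSR robustness measure $\Gamma^{\varphi}_{\bm{\epsilon},\bm{p},\bm{w}}$ be arbitrary, with every $\epsilon_i\in\mathbb{R}_{++}$, every $p_i\in\mathbb{Z}_{++}$, and every $w_i\in\mathbb{Z}_{++}^{n_i}$ (where $n_i$ is the number of arguments of the corresponding key function). Then $\Gamma^{\varphi}_{\bm{\epsilon},\bm{p},\bm{w}}(\cdot,k)$ is $\mathcal{C}^1$-smooth as a function of the signal; that is, if $N$ is such that $\Gamma^{\varphi}_{\bm{\epsilon},\bm{p},\bm{w}}(x,k)$ depends only on the samples $x_0,\dots,x_N$ (such $N$ exists because all time intervals in $\varphi$ are bounded), then $(x_0,\dots,x_N)\mapsto \Gamma^{\varphi}_{\bm{\epsilon},\bm{p},\bm{w}}(x,k)$ is continuously differentiable on $(\mathbb{R}^n)^{N+1}$.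
   Context: Notation. $\mathbb{Z}_+$ and $\mathbb{Z}_{++}$ are the non-negative and positive integers, $\mathbb{R}_+$ and $\mathbb{R}_{++}$ the non-negative and positive reals; $[a{:}b]$ is the set of integers $k$ with $a\le k\le b$ ($a,b\in\mathbb{Z}_+$, $a\le b$); $\bm{1}$ is the all-ones vector. For a signal $x$, $x_k$ denotes its value at time $k$. For $y\in\mathbb{R}^m$, $|y|_+^2:=(\max(y_1,0)^2,\dots,\max(y_m,0)^2)$ and $|y|_-^2:=(\min(y_1,0)^2,\dots,\min(y_m,0)^2)$. STL formulas. A predicate is $\mu=(f(x)\ge 0)$ with $f:\mathbb{R}^n\to\mathbb{R}$ its predicate function. Finite-time STL specifications are built recursively from finitely many predicates by $\neg\varphi$, $\varphi_1\wedge\varphi_2$, $\varphi_1\vee\varphi_2$, $\varphi_1\Rightarrow\varphi_2$, and the temporal operators eventually $\bm{F}_{[a:b]}\varphi$, always $\bm{G}_{[a:b]}\varphi$, until $\varphi_1\bm{U}_{[a:b]}\varphi_2$ over bounded non-empty intervals $[a{:}b]$. Key functions. For $m\in\mathbb{Z}_{++}$, $\epsilon\in\mathbb{R}_{++}$, $p\in\mathbb{Z}_{++}$, $w\in\mathbb{Z}_{++}^m$, and $z\in\mathbb{R}_+^m$, let $$M_{0,w}^{\epsilon}(z):=\Big(\epsilon^{\bm{1}^Tw}+\prod_{i=1}^m z_i^{w_i}\Big)^{1/\bm{1}^Tw},\qquad M_{p,w}^{\epsilon}(z):=\Big(\epsilon^p+\frac{1}{\bm{1}^Tw}\sum_{i=1}^m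 w_i z_i^p\Big)^{1/p},$$ and for $y\in\mathbb{R}^m$, $${}^{\wedge}h_{p,w}^{\epsilon}(y):=\big(M_{0,w}^{\epsilon}(|y|_+^2)\big)^{1/2}-\big(M_{p,w}^{\epsilon}(|y|_-^2)\big)^{1/2},\qquad {}^{\vee}h_{p,w}^{\epsilon}(y):=-{}^{\wedge}h_{p,w}^{\epsilon}(-y).$$ D-GMSR. $\Gamma^{\varphi}=\Gamma^{\varphi}_{\bm{\epsilon},\bm{p},\bm{w}}$ is defined recursively as follows, where $\bm{\epsilon},\bm{p},\bm{w}$ collect the parameters $\epsilon_i\in\mathbb{R}_{++}$, $p_i\in\mathbb{Z}_{++}$, $w_i$ (positive integer vectors of the appropriate length) used by the key functions occurring in the construction; each operator occurrence may have its own parameters, which do not depend on $x$ or $k$ (the parameters are suppressed from the key functions below): - $\Gamma^{\mu}(x,k):=f(x_k)$; $\Gamma^{\neg\varphi}(x,k):=-\Gamma^{\varphi}(x,k)$; - $\Gamma^{\varphi_1\wedge\varphi_2}(x,k):={}^{\wedge}h(\Gamma^{\varphi_1}(x,k),\Gamma^{\varphi_2}(x,k))$; - $\Gamma^{\varphi_1\vee\varphi_2}(x,k):={}^{\vee}h(\Gamma^{\varphi_1}(x,k),\Gamma^{\varphi_2}(x,k))$; - $\Gamma^{\varphi_1\Rightarrow\varphi_2}(x,k):={}^{\vee}h(-\Gamma^{\varphi_1}(x,k),\Gamma^{\varphi_2}(x,k))$; - $\Gamma^{\bm{F}_{[a:b]}\varphi}(x,k):={}^{\vee}h(\Gamma^{\varphi}(x,k+a),\Gamma^{\varphi}(x,k+a+1),\dots,\Gamma^{\varphi}(x,k+b))$;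 - $\Gamma^{\bm{G}_{[a:b]}\varphi}(x,k):={}^{\wedge}h(\Gamma^{\varphi}(x,k+a),\Gamma^{\varphi}(x,k+a+1),\dots,\Gamma^{\varphi}(x,k+b))$; - $\Gamma^{\varphi_1\bm{U}_{[a:b]}\varphi_2}(x,k):={}^{\vee}h(\eta_a,\eta_{a+1},\dots,\eta_b)$, where $\eta_j:={}^{\wedge}h(\Gamma^{\bm{G}_{[a:j]}\varphi_1}(x,k),\Gamma^{\varphi_2}(x,k+j))$ for $j\in[a{:}b]$. *)

theory Defs
  imports "HOL-Analysis.Analysis"
begin

definition C1_smooth :: "('a::real_normed_vector \<Rightarrow> 'b::real_normed_vector) \<Rightarrow> bool" where
  "C1_smooth f \<longleftrightarrow>
     (\<exists>f' :: 'a \<Rightarrow> ('a \<Rightarrow>\<^sub>L 'b).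
        (\<forall>x. (f has_derivative blinfun_apply (f' x)) (at x)) \<and> continuous_on UNIV f')"

text \<open>The formula \<open>Pred f\<close> stands for the predicate \<open>f(x) \<ge> 0\<close>.\<close>

datatype 's stl =
    Pred "'s \<Rightarrow> real"
  | Neg "'s stl"
  | And "'s stl" "'s stl"
  | Or "'s stl" "'s stl"
  | Imp "'s stl" "'s stl"
  | Ev nat nat "'s stl"
  | Alw nat nat "'s stl"
  | Until nat nat "'s stl" "'s stl"

primrec intervals_nonempty :: "'s stl \<Rightarrow> bool" where
  "intervals_nonempty (Pred f) \<longleftrightarrow> True"
| "intervals_nonempty (Neg \<phi>) \<longleftrightarrow> intervals_nonempty \<phi>"
| "intervals_nonempty (And \<phi> \<psi>) \<longleftrightarrow> intervals_nonempty \<phi> \<and> intervals_nonempty \<psi>"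
| "intervals_nonempty (Or \<phi> \<psi>) \<longleftrightarrow> intervals_nonempty \<phi> \<and> intervals_nonempty \<psi>"
| "intervals_nonempty (Imp \<phi> \<psi>) \<longleftrightarrow> intervals_nonempty \<phi> \<and> intervals_nonempty \<psi>"
| "intervals_nonempty (Ev a b \<phi>) \<longleftrightarrow> a \<le> b \<and> intervals_nonempty \<phi>"
| "intervals_nonempty (Alw a b \<phi>) \<longleftrightarrow> a \<le> b \<and> intervals_nonempty \<phi>"
| "intervals_nonempty (Until a b \<phi> \<psi>) \<longleftrightarrow>
     a \<le> b \<and> intervals_nonempty \<phi> \<and> intervals_nonempty \<psi>"

primrec predicate_functions :: "'s stl \<Rightarrow> ('s \<Rightarrow> real) set" where
  "predicate_functions (Pred f) = {f}"
| "predicate_functions (Neg \<phi>) = predicate_functions \<phi>"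
| "predicate_functions (And \<phi> \<psi>) = predicate_functions \<phi> \<union> predicate_functions \<psi>"
| "predicate_functions (Or \<phi> \<psi>) = predicate_functions \<phi> \<union> predicate_functions \<psi>"
| "predicate_functions (Imp \<phi> \<psi>) = predicate_functions \<phi> \<union> predicate_functions \<psi>"
| "predicate_functions (Ev a b \<phi>) = predicate_functions \<phi>"
| "predicate_functions (Alw a b \<phi>) = predicate_functions \<phi>"
| "predicate_functions (Until a b \<phi> \<psi>) = predicate_functions \<phi> \<union> predicate_functions \<psi>"

text \<open>Vectors in \<open>\<real>\<^sup>m\<close> and weight vectors are lists of length \<open>m\<close>, since the number of arguments
  of a key function varies within one formula.\<close>

definition M_zero :: "real \<Rightarrow> nat list \<Rightarrow> real list \<Rightarrow> real" where
  "M_zero \<epsilon> w z =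
     root (sum_list w) (\<epsilon> ^ sum_list w + (\<Prod>i<length z. (z ! i) ^ (w ! i)))"

definition M_pow :: "real \<Rightarrow> nat \<Rightarrow> nat list \<Rightarrow> real list \<Rightarrow> real" where
  "M_pow \<epsilon> p w z =
     root p (\<epsilon> ^ p + 1 / real (sum_list w) * (\<Sum>i<length z. real (w ! i) * (z ! i) ^ p))"

datatype key_param = KeyParam (key_eps: real) (key_exp: nat) (key_wts: "nat list")

definition valid_key :: "key_param \<Rightarrow> nat \<Rightarrow> bool" where
  "valid_key K m \<longleftrightarrow>
     key_eps K > 0 \<and> key_exp K > 0 \<and> length (key_wts K) = m \<and> (\<forall>v\<in>set (key_wts K). v > 0)"

definition and_h :: "key_param \<Rightarrow> real list \<Rightarrow> real" where
  "and_h K y =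
     sqrt (M_zero (key_eps K) (key_wts K) (map (\<lambda>t. (max t 0)\<^sup>2) y)) -
     sqrt (M_pow (key_eps K) (key_exp K) (key_wts K) (map (\<lambda>t. (min t 0)\<^sup>2) y))"

definition or_h :: "key_param \<Rightarrow> real list \<Rightarrow> real" where
  "or_h K y = - and_h K (map uminus y)"

text \<open>A parameter assignment gives a parameter triple to every key function used in the
  construction, addressed by its position. The position \<open>[]\<close> addresses the outermost key function,
  and \<open>Arg1\<close>, \<open>Arg2\<close> descend to the operands. An until operator also uses, for each \<open>j\<close>,
  the key function defining \<open>\<eta>\<^sub>j\<close>, at \<open>[Eta j]\<close>, and the one of the auxiliary always-formula over
  \<open>[a:j]\<close>, at \<open>[Glob j]\<close>.\<close>

datatype pos_step = Arg1 | Arg2 | Eta nat | Glob nat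

type_synonym param_assignment = "pos_step list \<Rightarrow> key_param"

definition sub_params :: "pos_step \<Rightarrow> param_assignment \<Rightarrow> param_assignment" where
  "sub_params s \<theta> = (\<lambda>q. \<theta> (s # q))"

primrec valid_params :: "'s stl \<Rightarrow> param_assignment \<Rightarrow> bool" where
  "valid_params (Pred f) \<theta> \<longleftrightarrow> True"
| "valid_params (Neg \<phi>) \<theta> \<longleftrightarrow> valid_params \<phi> (sub_params Arg1 \<theta>)"
| "valid_params (And \<phi> \<psi>) \<theta> \<longleftrightarrow>
     valid_key (\<theta> []) 2 \<and>
     valid_params \<phi> (sub_params Arg1 \<theta>) \<and> valid_params \<psi> (sub_params Arg2 \<theta>)"
| "valid_params (Or \<phi> \<psi>) \<theta> \<longleftrightarrow>
     valid_key (\<theta> []) 2 \<and>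
     valid_params \<phi> (sub_params Arg1 \<theta>) \<and> valid_params \<psi> (sub_params Arg2 \<theta>)"
| "valid_params (Imp \<phi> \<psi>) \<theta> \<longleftrightarrow>
     valid_key (\<theta> []) 2 \<and>
     valid_params \<phi> (sub_params Arg1 \<theta>) \<and> valid_params \<psi> (sub_params Arg2 \<theta>)"
| "valid_params (Ev a b \<phi>) \<theta> \<longleftrightarrow>
     valid_key (\<theta> []) (b - a + 1) \<and> valid_params \<phi> (sub_params Arg1 \<theta>)"
| "valid_params (Alw a b \<phi>) \<theta> \<longleftrightarrow>
     valid_key (\<theta> []) (b - a + 1) \<and> valid_params \<phi> (sub_params Arg1 \<theta>)"
| "valid_params (Until a b \<phi> \<psi>) \<theta> \<longleftrightarrow>
     valid_key (\<theta> []) (b - a + 1) \<and>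
     (\<forall>j\<in>{a..b}. valid_key (\<theta> [Eta j]) 2 \<and> valid_key (\<theta> [Glob j]) (j - a + 1)) \<and>
     valid_params \<phi> (sub_params Arg1 \<theta>) \<and> valid_params \<psi> (sub_params Arg2 \<theta>)"

primrec dgmsr :: "'s stl \<Rightarrow> param_assignment \<Rightarrow> (nat \<Rightarrow> 's) \<Rightarrow> nat \<Rightarrow> real" where
  "dgmsr (Pred f) \<theta> x k = f (x k)"
| "dgmsr (Neg \<phi>) \<theta> x k = - dgmsr \<phi> (sub_params Arg1 \<theta>) x k"
| "dgmsr (And \<phi> \<psi>) \<theta> x k =
     and_h (\<theta> []) [dgmsr \<phi> (sub_params Arg1 \<theta>) x k, dgmsr \<psi> (sub_params Arg2 \<theta>) x k]"
| "dgmsr (Or \<phi> \<psi>) \<theta> x k =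
     or_h (\<theta> []) [dgmsr \<phi> (sub_params Arg1 \<theta>) x k, dgmsr \<psi> (sub_params Arg2 \<theta>) x k]"
| "dgmsr (Imp \<phi> \<psi>) \<theta> x k =
     or_h (\<theta> []) [- dgmsr \<phi> (sub_params Arg1 \<theta>) x k, dgmsr \<psi> (sub_params Arg2 \<theta>) x k]"
| "dgmsr (Ev a b \<phi>) \<theta> x k =
     or_h (\<theta> []) (map (\<lambda>i. dgmsr \<phi> (sub_params Arg1 \<theta>) x (k + i)) [a..<Suc b])"
| "dgmsr (Alw a b \<phi>) \<theta> x k =
     and_h (\<theta> []) (map (\<lambda>i. dgmsr \<phi> (sub_params Arg1 \<theta>) x (k + i)) [a..<Suc b])"
| "dgmsr (Until a b \<phi> \<psi>) \<theta> x k =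
     or_h (\<theta> [])
       (map (\<lambda>j. and_h (\<theta> [Eta j])
                   [and_h (\<theta> [Glob j])
                      (map (\<lambda>i. dgmsr \<phi> (sub_params Arg1 \<theta>) x (k + i)) [a..<Suc j]),
                    dgmsr \<psi> (sub_params Arg2 \<theta>) x (k + j)])
            [a..<Suc b])"

definition depends_on_samples :: "((nat \<Rightarrow> 's) \<Rightarrow> real) \<Rightarrow> nat \<Rightarrow> bool" where
  "depends_on_samples G N \<longleftrightarrow> (\<forall>x y. (\<forall>i\<le>N. x i = y i) \<longrightarrow> G x = G y)"

text \<open>The sample tuple \<open>(x\<^sub>0, \<dots>, x\<^sub>N)\<close> is a vector \<open>X\<close> whose index type has \<open>N + 1\<close> elements
  enumerated by \<open>e\<close>. It is extended to a signal by \<open>0\<close>; for a functional that depends only on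
  the samples up to \<open>N\<close> the choice of extension is irrelevant.\<close>

definition signal_of :: "(nat \<Rightarrow> 'm::finite) \<Rightarrow> nat \<Rightarrow> 's::zero ^ 'm \<Rightarrow> nat \<Rightarrow> 's" where
  "signal_of e N X i = (if i \<le> N then X $ e i else 0)"

end

theory Submission imports Defs begin

text \<open>The functions \<open>max(t, 0)\<^sup>2\<close> and \<open>min(t, 0)\<^sup>2\<close> are \<open>C\<^sup>1\<close>, since their one-sided derivatives agree at \<open>0\<close>,
  and \<open>\<epsilon> > 0\<close> keeps the arguments of all roots away from \<open>0\<close>, where roots are not differentiable.
  Hence every key function is \<open>C\<^sup>1\<close>, and so are the compositions of them that make up the
  robustness measure.\<close>

section \<open>Closure properties of continuously differentiable functions\<close>

lemma C1_smoothI: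
  assumes "\<And>x. (f has_derivative blinfun_apply (f' x)) (at x)" "continuous_on UNIV f'"
  shows "C1_smooth f"
  using assms unfolding C1_smooth_def by blast

lemma C1_smooth_imp_continuous_on:
  assumes "C1_smooth f"
  shows "continuous_on UNIV f"
proof -
  obtain f' where "\<And>x. (f has_derivative blinfun_apply (f' x)) (at x)"
    using assms unfolding C1_smooth_def by blast
  then show ?thesis
    by (intro has_derivative_continuous_on)
qed

lemma C1_smooth_const: "C1_smooth (\<lambda>x. c)"
  unfolding C1_smooth_def
  by (rule exI[of _ "\<lambda>x. 0"]) (auto simp: zero_blinfun.rep_eq)

lemma C1_smooth_add:
  assumes "C1_smooth f" "C1_smooth g"
  shows "C1_smooth (\<lambda>x. f x + g x)"
proof -
  obtain f' g' where f: "\<And>x. (f has_derivative blinfun_apply (f' x)) (at x)" "continuous_on UNIV f'"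
    and g: "\<And>x. (g has_derivative blinfun_apply (g' x)) (at x)" "continuous_on UNIV g'"
    using assms unfolding C1_smooth_def by blast
  have "((\<lambda>x. f x + g x) has_derivative blinfun_apply (f' x + g' x)) (at x)" for x
    using has_derivative_add[OF f(1) g(1)] by (simp add: plus_blinfun.rep_eq)
  then show ?thesis
    using continuous_on_add[OF f(2) g(2)] by (rule C1_smoothI)
qed

lemma C1_smooth_mult:
  fixes f g :: "'a::real_normed_vector \<Rightarrow> real"
  assumes "C1_smooth f" "C1_smooth g"
  shows "C1_smooth (\<lambda>x. f x * g x)"
proof -
  obtain f' g' where f: "\<And>x. (f has_derivative blinfun_apply (f' x)) (at x)" "continuous_on UNIV f'"
    and g: "\<And>x. (g has_derivative blinfun_apply (g' x)) (at x)" "continuous_on UNIV g'"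
    using assms unfolding C1_smooth_def by blast
  have cont: "continuous_on UNIV (\<lambda>x. f x *\<^sub>R g' x + g x *\<^sub>R f' x)"
    by (intro continuous_on_add continuous_on_scaleR C1_smooth_imp_continuous_on assms f(2) g(2))
  have "((\<lambda>x. f x * g x) has_derivative
      blinfun_apply (f x *\<^sub>R g' x + g x *\<^sub>R f' x)) (at x)" for x
    using has_derivative_mult[OF f(1) g(1)]
    by (simp add: plus_blinfun.rep_eq scaleR_blinfun.rep_eq mult.commute)
  then show ?thesis
    using cont by (rule C1_smoothI)
qed

lemma C1_smooth_sum:
  assumes "\<And>i. i \<in> A \<Longrightarrow> C1_smooth (f i)"
  shows "C1_smooth (\<lambda>x. \<Sum>i\<in>A. f i x)"
  using assms
  \<comment> \<open>For an infinite index set the sum is \<open>0\<close> by convention, hence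
    constant.\<close>
  by (induction A rule: infinite_finite_induct) (auto intro: C1_smooth_const C1_smooth_add)

lemma C1_smooth_prod:
  fixes f :: "'i \<Rightarrow> 'a::real_normed_vector \<Rightarrow> real"
  assumes "\<And>i. i \<in> A \<Longrightarrow> C1_smooth (f i)"
  shows "C1_smooth (\<lambda>x. \<Prod>i\<in>A. f i x)"
  using assms
  by (induction A rule: infinite_finite_induct) (auto intro: C1_smooth_const C1_smooth_mult)

lemma C1_smooth_power:
  fixes f :: "'a::real_normed_vector \<Rightarrow> real"
  assumes "C1_smooth f"
  shows "C1_smooth (\<lambda>x. f x ^ n)"
  using assms by (induction n) (auto intro: C1_smooth_const C1_smooth_mult)

text \<open>Chain rule with scalar outer derivative \<open>g'\<close>. Differentiability of
  \<open>g\<close> and continuity of \<open>g'\<close> are asked for only on the range of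
  \<open>f\<close>, so that the rule applies to roots of positive functions.\<close>

lemma C1_smooth_compose_real:
  fixes f :: "'a::real_normed_vector \<Rightarrow> real"
  assumes "C1_smooth f"
    and g: "\<And>x. (g has_real_derivative g' (f x)) (at (f x))"
    and g': "continuous_on (range f) g'"
  shows "C1_smooth (\<lambda>x. g (f x))"
proof -
  obtain f' where f: "\<And>x. (f has_derivative blinfun_apply (f' x)) (at x)" "continuous_on UNIV f'"
    using assms unfolding C1_smooth_def by blast
  have "continuous_on UNIV (\<lambda>x. g' (f x))"
    using continuous_on_compose2[OF g' C1_smooth_imp_continuous_on[OF assms(1)]] by simp
  moreover have "((\<lambda>x. g (f x)) has_derivative blinfun_apply (g' (f x) *\<^sub>R f' x)) (at x)" for x
    using has_derivative_compose[OF f(1) g[unfolded has_field_derivative_def], of x]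
    by (simp add: blinfun.scaleR_left[abs_def])
  ultimately show ?thesis
    by (intro C1_smoothI[of _ "\<lambda>x. g' (f x) *\<^sub>R f' x"] continuous_on_scaleR f(2))
qed

lemma C1_smooth_minus:
  fixes f :: "'a::real_normed_vector \<Rightarrow> real"
  assumes "C1_smooth f"
  shows "C1_smooth (\<lambda>x. - f x)"
  using C1_smooth_mult[OF C1_smooth_const[of "-1"] assms] by simp

text \<open>The derivative of \<open>L\<close> is \<open>L\<close> itself at every point, so the
  composed derivative varies with \<open>x\<close> only through \<open>f' (L x)\<close>. This serves
  for reading off one sample of a signal.\<close>

lemma C1_smooth_compose_linear:
  assumes "C1_smooth f" and L: "bounded_linear L"
  shows "C1_smooth (\<lambda>x. f (L x))"
proof -
  obtain f' where f: "\<And>x. (f has_derivative blinfun_apply (f' x)) (at x)" "continuous_on UNIV f'"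
    using assms unfolding C1_smooth_def by blast
  have "((\<lambda>x. f (L x)) has_derivative blinfun_apply (f' (L x) o\<^sub>L Blinfun L)) (at x)" for x
    using has_derivative_compose[OF bounded_linear_imp_has_derivative[OF L, of "at x"] f(1)]
    by (simp add: bounded_linear_Blinfun_apply[OF L] o_def blinfun_compose.rep_eq)
  moreover have "continuous_on UNIV (\<lambda>x. f' (L x))"
    by (rule continuous_on_compose2[OF f(2) linear_continuous_on[OF L]]) auto
  then have "continuous_on UNIV (\<lambda>x. f' (L x) o\<^sub>L Blinfun L)"
    by (intro continuous_intros)
  ultimately show ?thesis
    by (rule C1_smoothI)
qed

section \<open>Roots and squared positive and negative parts\<close>

lemma C1_smooth_root:
  fixes f :: "'a::real_normed_vector \<Rightarrow> real"
  assumes "C1_smooth f" and pos: "\<And>x. f x > 0" and "n > 0"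
  shows "C1_smooth (\<lambda>x. root n (f x))"
proof (rule C1_smooth_compose_real[OF assms(1)])
  show "(root n has_real_derivative inverse (real n * root n (f x) ^ (n - Suc 0))) (at (f x))" for x
    using DERIV_real_root[OF \<open>n > 0\<close> pos] .
  show "continuous_on (range f) (\<lambda>t. inverse (real n * root n t ^ (n - Suc 0)))"
    using pos \<open>n > 0\<close> by (auto intro!: continuous_intros simp: less_imp_neq[OF pos, symmetric])
qed

text \<open>The function is glued from the square on \<open>{0..}\<close> and the zero function on
  \<open>{..<0}\<close>. The closures of these sets meet only at \<open>0\<close>, where both values
  and both derivatives vanish.\<close>

lemma has_real_derivative_max_zero_square:
  "((\<lambda>t. (max t 0)\<^sup>2) has_real_derivative 2 * max t 0) (at t)"
proof -
  have "((\<lambda>t::real. if t \<in> {0..} then t\<^sup>2 else 0) has_derivative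
      (if t \<in> {0..} then (\<lambda>h. h * (2 * t)) else (\<lambda>h. 0))) (at t within {0..} \<union> {..<0})"
    by (rule has_derivative_If_within_closures[where f' = "\<lambda>t h. h * (2 * t)" and g' = "\<lambda>t h. 0"])
       (auto intro!: derivative_eq_intros)
  moreover have "{0..} \<union> {..<0} = (UNIV :: real set)"
    by auto
  moreover have "(\<lambda>t::real. if t \<in> {0..} then t\<^sup>2 else 0) = (\<lambda>t. (max t 0)\<^sup>2)"
    by (auto simp: fun_eq_iff max_def)
  moreover have "(if t \<in> {0..} then (\<lambda>h. h * (2 * t)) else (\<lambda>h. 0)) = (*) (2 * max t 0)"
    by (auto simp: fun_eq_iff max_def)
  ultimately show ?thesis
    by (simp add: has_field_derivative_def)
qed

lemma C1_smooth_max_zero_square: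
  fixes f :: "'a::real_normed_vector \<Rightarrow> real"
  assumes "C1_smooth f"
  shows "C1_smooth (\<lambda>x. (max (f x) 0)\<^sup>2)"
  by (rule C1_smooth_compose_real[OF assms has_real_derivative_max_zero_square])
     (intro continuous_intros)

lemma C1_smooth_min_zero_square:
  fixes f :: "'a::real_normed_vector \<Rightarrow> real"
  assumes "C1_smooth f"
  shows "C1_smooth (\<lambda>x. (min (f x) 0)\<^sup>2)"
proof -
  have "(min t 0)\<^sup>2 = (max (- t) 0)\<^sup>2" for t :: real
    by (auto simp: min_def max_def)
  then show ?thesis
    using C1_smooth_max_zero_square[OF C1_smooth_minus[OF assms]] by simp
qed

section \<open>Key functions\<close>

text \<open>The arguments form a list of functions evaluated at a common point, so one statement
  covers every arity.\<close>

lemma C1_smooth_and_h: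
  fixes gs :: "('a::real_normed_vector \<Rightarrow> real) list"
  assumes K: "valid_key K (length gs)" and ne: "gs \<noteq> []"
    and gs: "\<And>g. g \<in> set gs \<Longrightarrow> C1_smooth g"
  shows "C1_smooth (\<lambda>x. and_h K (map (\<lambda>g. g x) gs))"
proof -
  define \<epsilon> p w where "\<epsilon> = key_eps K" "p = key_exp K" "w = key_wts K"
  have pos: "\<epsilon> > 0" "p > 0" and w: "w \<noteq> []" "\<And>v. v \<in> set w \<Longrightarrow> v > 0"
    using K ne by (auto simp: valid_key_def \<epsilon>_p_w_def)
  \<comment> \<open>At least one weight exists and all are positive, so the index of the root in
    \<open>M_zero\<close> is positive.\<close>
  have W: "sum_list w > 0"
    using w by (cases w) auto
  define A B where
    "A x = \<epsilon> ^ sum_list w + (\<Prod>i<length gs. ((max ((gs ! i) x) 0)\<^sup>2) ^ (w ! i))" and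
    "B x = \<epsilon> ^ p + 1 / real (sum_list w) *
       (\<Sum>i<length gs. real (w ! i) * ((min ((gs ! i) x) 0)\<^sup>2) ^ p)" for x
  have A: "C1_smooth A" and B: "C1_smooth B"
    unfolding A_def B_def
    by (intro C1_smooth_add C1_smooth_mult C1_smooth_const C1_smooth_prod C1_smooth_sum
        C1_smooth_power C1_smooth_max_zero_square C1_smooth_min_zero_square gs; simp)+
  \<comment> \<open>A power of \<open>\<epsilon>\<close> is positive, and the remaining term is
    non-negative, being built from squares and non-negative coefficients.\<close>
  have A_pos: "A x > 0" and B_pos: "B x > 0" for x
    unfolding A_def B_def using pos
    by (intro add_pos_nonneg zero_less_power mult_nonneg_nonneg prod_nonneg sum_nonneg; simp)+
  \<comment> \<open>Writing \<open>sqrt\<close> as \<open>root 2\<close> lets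
    \<open>C1_smooth_root\<close> handle both nested roots; the difference becomes a sum with a
    negated term to fit the closure rules.\<close>
  have "and_h K (map (\<lambda>g. g x) gs) = root 2 (root (sum_list w) (A x)) + - root 2 (root p (B x))" for x
    by (simp add: and_h_def M_zero_def M_pow_def A_def B_def \<epsilon>_p_w_def sqrt_def)
  then show ?thesis
    using W pos(2) A_pos B_pos
    by (simp only:)
       (intro C1_smooth_add C1_smooth_minus C1_smooth_root A B real_root_gt_zero; simp)
qed

text \<open>By duality: the inner negation is absorbed into the list of functions, which reduces the
  claim to \<open>and_h\<close>.\<close>

lemma C1_smooth_or_h:
  fixes gs :: "('a::real_normed_vector \<Rightarrow> real) list"
  assumes "valid_key K (length gs)" and "gs \<noteq> []"
    and "\<And>g. g \<in> set gs \<Longrightarrow> C1_smooth g"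
  shows "C1_smooth (\<lambda>x. or_h K (map (\<lambda>g. g x) gs))"
proof -
  have "C1_smooth (\<lambda>x. and_h K (map (\<lambda>g. g x) (map (\<lambda>g x. - g x) gs)))"
    using assms by (intro C1_smooth_and_h) (auto intro: C1_smooth_minus)
  then show ?thesis
    by (simp add: or_h_def o_def C1_smooth_minus)
qed

lemma C1_smooth_and_h_binary:
  fixes f g :: "'a::real_normed_vector \<Rightarrow> real"
  assumes "valid_key K 2" "C1_smooth f" "C1_smooth g"
  shows "C1_smooth (\<lambda>x. and_h K [f x, g x])"
proof -
  have "C1_smooth (\<lambda>x. and_h K (map (\<lambda>h. h x) [f, g]))"
    using assms by (intro C1_smooth_and_h) (auto simp: numeral_2_eq_2)
  then show ?thesis
    by simp
qed

lemma C1_smooth_or_h_binary: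
  fixes f g :: "'a::real_normed_vector \<Rightarrow> real"
  assumes "valid_key K 2" "C1_smooth f" "C1_smooth g"
  shows "C1_smooth (\<lambda>x. or_h K [f x, g x])"
proof -
  have "C1_smooth (\<lambda>x. or_h K (map (\<lambda>h. h x) [f, g]))"
    using assms by (intro C1_smooth_or_h) (auto simp: numeral_2_eq_2)
  then show ?thesis
    by simp
qed

section \<open>The robustness measure\<close>

text \<open>Induction on the formula, with the signal given by any family \<open>x\<close> whose
  samples are bounded linear in \<open>X\<close>; the induction thus never sees how samples are
  stored. Time and parameters are generalised because temporal operators shift \<open>k\<close> and
  operands use \<open>sub_params\<close>.\<close>

lemma C1_smooth_dgmsr:
  fixes x :: "'a::real_normed_vector \<Rightarrow> nat \<Rightarrow> 's::real_normed_vector"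
  assumes "\<And>i. bounded_linear (\<lambda>X. x X i)"
    and "intervals_nonempty \<phi>" "\<forall>f\<in>predicate_functions \<phi>. C1_smooth f" "valid_params \<phi> \<theta>"
  shows "C1_smooth (\<lambda>X. dgmsr \<phi> \<theta> (x X) k)"
  using assms(2-)
proof (induction \<phi> arbitrary: \<theta> k)
  case (Pred f)
  then show ?case
    using C1_smooth_compose_linear[OF _ assms(1)] by simp
next
  case (Neg \<phi>)
  then show ?case
    by (simp add: C1_smooth_minus)
next
  case (And \<phi> \<psi>)
  then show ?case
    by (auto intro!: C1_smooth_and_h_binary)
next
  case (Or \<phi> \<psi>)
  then show ?case
    by (auto intro!: C1_smooth_or_h_binary)
next
  case (Imp \<phi> \<psi>)
  then show ?case
    by (auto intro!: C1_smooth_or_h_binary C1_smooth_minus)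
next
  case (Ev a b \<phi>)
  let ?f = "\<lambda>i X. dgmsr \<phi> (sub_params Arg1 \<theta>) (x X) (k + i)"
  \<comment> \<open>The window has \<open>Suc b - a\<close> entries; since \<open>a \<le> b\<close>,
    this is the arity \<open>b - a + 1\<close> fixed by \<open>valid_params\<close>, and the list is
    non-empty.\<close>
  have "C1_smooth (\<lambda>X. or_h (\<theta> []) (map (\<lambda>g. g X) (map ?f [a..<Suc b])))"
    using Ev by (intro C1_smooth_or_h) (auto simp: Suc_diff_le)
  then show ?case
    by (simp add: o_def del: upt_Suc)
next
  case (Alw a b \<phi>)
  let ?f = "\<lambda>i X. dgmsr \<phi> (sub_params Arg1 \<theta>) (x X) (k + i)"
  have "C1_smooth (\<lambda>X. and_h (\<theta> []) (map (\<lambda>g. g X) (map ?f [a..<Suc b])))"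
    using Alw by (intro C1_smooth_and_h) (auto simp: Suc_diff_le)
  then show ?case
    by (simp add: o_def del: upt_Suc)
next
  case (Until a b \<phi> \<psi>)
  let ?f = "\<lambda>i X. dgmsr \<phi> (sub_params Arg1 \<theta>) (x X) (k + i)"
  let ?g = "\<lambda>j X. dgmsr \<psi> (sub_params Arg2 \<theta>) (x X) (k + j)"
  let ?glob = "\<lambda>j X. and_h (\<theta> [Glob j]) (map (\<lambda>i. ?f i X) [a..<Suc j])"
  let ?eta = "\<lambda>j X. and_h (\<theta> [Eta j]) [?glob j X, ?g j X]"
  \<comment> \<open>The until case works from the inside out: the always-value over
    \<open>[a..<Suc j]\<close>, then its conjunction with the second operand, then the disjunction
    over \<open>j\<close>.\<close>
  have glob: "C1_smooth (?glob j)" if "j \<in> {a..b}" for j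
  proof -
    have "C1_smooth (\<lambda>X. and_h (\<theta> [Glob j]) (map (\<lambda>g. g X) (map ?f [a..<Suc j])))"
      using Until that by (intro C1_smooth_and_h) (auto simp: Suc_diff_le)
    then show ?thesis
      by (simp add: o_def del: upt_Suc)
  qed
  have eta: "C1_smooth (?eta j)" if "j \<in> {a..b}" for j
    using glob[OF that] Until that
    by (intro C1_smooth_and_h_binary) auto
  have "C1_smooth (\<lambda>X. or_h (\<theta> []) (map (\<lambda>g. g X) (map ?eta [a..<Suc b])))"
    using Until.prems eta by (intro C1_smooth_or_h) (auto simp: Suc_diff_le simp del: upt_Suc)
  then show ?case
    by (simp add: o_def del: upt_Suc)
qed

section \<open>Dependence on finitely many samples\<close>

text \<open>A bound on the sample indices read at time \<open>k\<close>, obtained by moving to the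
  right end of each interval. In the until case the inner windows end at some
  \<open>j \<le> b\<close>, so shifting by \<open>b\<close> covers both operands.\<close>

primrec horizon :: "'s stl \<Rightarrow> nat \<Rightarrow> nat" where
  "horizon (Pred f) k = k"
| "horizon (Neg \<phi>) k = horizon \<phi> k"
| "horizon (And \<phi> \<psi>) k = max (horizon \<phi> k) (horizon \<psi> k)"
| "horizon (Or \<phi> \<psi>) k = max (horizon \<phi> k) (horizon \<psi> k)"
| "horizon (Imp \<phi> \<psi>) k = max (horizon \<phi> k) (horizon \<psi> k)"
| "horizon (Ev a b \<phi>) k = horizon \<phi> (k + b)"
| "horizon (Alw a b \<phi>) k = horizon \<phi> (k + b)"
| "horizon (Until a b \<phi> \<psi>) k = max (horizon \<phi> (k + b)) (horizon \<psi> (k + b))"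

text \<open>Ensures that the bound at \<open>k + b\<close> also covers evaluation at each earlier
  time \<open>k + i\<close> of a window.\<close>

lemma horizon_mono: "k \<le> l \<Longrightarrow> horizon \<phi> k \<le> horizon \<phi> l"
  by (induction \<phi> arbitrary: k l) (auto intro: max.coboundedI1 max.coboundedI2)

lemma dgmsr_cong:
  assumes "\<And>i. i \<le> horizon \<phi> k \<Longrightarrow> x i = y i"
  shows "dgmsr \<phi> \<theta> x k = dgmsr \<phi> \<theta> y k"
  using assms
proof (induction \<phi> arbitrary: \<theta> k)
  case (Ev a b \<phi>)
  have "dgmsr \<phi> \<theta>' x (k + i) = dgmsr \<phi> \<theta>' y (k + i)" if "i \<le> b" for i \<theta>'
    using horizon_mono[of "k + i" "k + b" \<phi>] that
    by (intro Ev.IH Ev.prems) auto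
  then show ?case
    by (auto intro!: arg_cong[of _ _ "or_h _"] simp del: upt_Suc)
next
  case (Alw a b \<phi>)
  have "dgmsr \<phi> \<theta>' x (k + i) = dgmsr \<phi> \<theta>' y (k + i)" if "i \<le> b" for i \<theta>'
    using horizon_mono[of "k + i" "k + b" \<phi>] that
    by (intro Alw.IH Alw.prems) auto
  then show ?case
    by (auto intro!: arg_cong[of _ _ "and_h _"] simp del: upt_Suc)
next
  case (Until a b \<phi> \<psi>)
  have 1: "dgmsr \<phi> \<theta>' x (k + i) = dgmsr \<phi> \<theta>' y (k + i)" if "i \<le> b" for i \<theta>'
    using horizon_mono[of "k + i" "k + b" \<phi>] that
    by (intro Until.IH(1) Until.prems) (auto simp: le_max_iff_disj)
  have 2: "dgmsr \<psi> \<theta>' x (k + i) = dgmsr \<psi> \<theta>' y (k + i)" if "i \<le> b" for i \<theta>'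
    using horizon_mono[of "k + i" "k + b" \<psi>] that
    by (intro Until.IH(2) Until.prems) (auto simp: le_max_iff_disj)
  \<comment> \<open>Every index of the inner window is at most \<open>j\<close>, hence at most
    \<open>b\<close>, so fact \<open>1\<close> applies entrywise.\<close>
  have "and_h K (map (\<lambda>i. dgmsr \<phi> \<theta>' x (k + i)) [a..<Suc j]) =
      and_h K (map (\<lambda>i. dgmsr \<phi> \<theta>' y (k + i)) [a..<Suc j])" if "j \<le> b" for j K \<theta>'
    using that by (auto intro!: 1 arg_cong[of _ _ "and_h _"] simp del: upt_Suc)
  with 2 show ?case
    by (auto intro!: arg_cong[of _ _ "or_h _"] simp del: upt_Suc)
next
  case (And \<phi> \<psi>)
  have "dgmsr \<phi> \<theta>' x k = dgmsr \<phi> \<theta>' y k" "dgmsr \<psi> \<theta>' x k = dgmsr \<psi> \<theta>' y k" for \<theta>'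
    using And.prems by (auto intro!: And.IH simp: le_max_iff_disj)
  then show ?case by simp
next
  case (Or \<phi> \<psi>)
  have "dgmsr \<phi> \<theta>' x k = dgmsr \<phi> \<theta>' y k" "dgmsr \<psi> \<theta>' x k = dgmsr \<psi> \<theta>' y k" for \<theta>'
    using Or.prems by (auto intro!: Or.IH simp: le_max_iff_disj)
  then show ?case by simp
next
  case (Imp \<phi> \<psi>)
  have "dgmsr \<phi> \<theta>' x k = dgmsr \<phi> \<theta>' y k" "dgmsr \<psi> \<theta>' x k = dgmsr \<psi> \<theta>' y k" for \<theta>'
    using Imp.prems by (auto intro!: Imp.IH simp: le_max_iff_disj)
  then show ?case by simp
qed simp_all

lemma depends_on_samples_horizon: "depends_on_samples (\<lambda>x. dgmsr \<phi> \<theta> x k) (horizon \<phi> k)"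
  unfolding depends_on_samples_def by (blast intro: dgmsr_cong)

theorem lemma1:
  fixes \<phi> :: "(real ^ 'n) stl"
    and \<theta> :: param_assignment
    and k N :: nat
    and e :: "nat \<Rightarrow> 'm::finite"
  assumes "intervals_nonempty \<phi>"
    and "\<forall>f\<in>predicate_functions \<phi>. C1_smooth f"
    and "valid_params \<phi> \<theta>"
    and "bij_betw e {0..N} (UNIV :: 'm set)"
  shows "(\<exists>N'. depends_on_samples (\<lambda>x. dgmsr \<phi> \<theta> x k) N') \<and>
         (depends_on_samples (\<lambda>x. dgmsr \<phi> \<theta> x k) N \<longrightarrow>
            C1_smooth (\<lambda>X :: (real ^ 'n) ^ 'm. dgmsr \<phi> \<theta> (signal_of e N X) k))"
proof -
  \<comment> \<open>Sample \<open>i\<close> is a coordinate projection for \<open>i \<le> N\<close>;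
    beyond that the extension by \<open>0\<close> makes it the zero map.\<close>
  have "bounded_linear (\<lambda>X :: (real ^ 'n) ^ 'm. signal_of e N X i)" for i
    by (cases "i \<le> N") (auto simp: signal_of_def intro: bounded_linear_vec_nth)
  \<comment> \<open>The witness for \<open>N'\<close> is \<open>horizon \<phi> k\<close>.\<close>
  then show ?thesis
    using C1_smooth_dgmsr assms(1-3) depends_on_samples_horizon by blast
qed

end
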